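(* For the cake-cutting share, and hence also for the envy-free share, $\alpha(n,\cdot)=\Omega(\sqrt{n})$. That is, there is an absolute constant $c>0$ such that, for each of these two notions of share, $\alpha(n,\cdot)\ge c\sqrt{n}$ for all integers $n\ge 1$.
   Context: A fair division instance $\mathcal{I}=\langle [n],[m],V\rangle$ consists of $n$ agents, $m$ homogeneous divisible items, and valuations $V=(v_1,\dots,v_n)$, where $v_{ik}\ge 0$ is agent $i$'s value for all of item $k$. A bundle is a vector $B\in[0,1]^m$, and $u_i(B)=\sum_{k\in[m]} v_{ik}B(k)$. An allocation is a tuple $\mathcal{A}=(A_1,\dots,A_n)$ of bundles with $\sum_{i\in[n]}A_i(k)\le 1$ for every $k\in[m]$; $\mathcal{P}(n,m)$ is the set of all allocations. Envy-free share: $\mathrm{EFS}_i(\mathcal{I})=\max u_i(A_i)$ over all $\mathcal{A}\in\mathcal{P}(n,m)$ such that $u_j(A_i)\le u_j(A_j)$ for all $j\in[n]\setminus\{i\}$. Cake-cutting share: $\mathrm{CCS}_i(\mathcal{I})=\max u_i(A_i)$ over all $\mathcal{A}\in\mathcal{P}(n,m)$ such that $u_j(A_i)\le u_j(A_{j'})$ for all $j,j'\in[n]\setminus\{i\}$. For a notion of share assigning a value $s_i(\mathcal{I})$ to each agent, $\alpha(n,m)$ is the smallest $\alpha\ge1$ such that every instance with $n$ agents and $m$ items has an allocation with $u_i(A_i)\ge s_i(\mathcal{I})/\alpha$ for all $i$; $\alpha(n,\cdot)$ is the worst case (supremum) of $\alpha(n,m)$ over all $m$. *)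

theory Defs
  imports "HOL-Analysis.Analysis"
begin

text \<open>
  Agents are the numbers below \<open>n\<close> and items the numbers below \<open>m\<close>; valuations, bundles and
  allocations are functions whose values outside these ranges are irrelevant.
\<close>

definition fair_division_instance :: "nat \<Rightarrow> nat \<Rightarrow> (nat \<Rightarrow> nat \<Rightarrow> real) \<Rightarrow> bool" where
  "fair_division_instance n m v \<longleftrightarrow> (\<forall>i<n. \<forall>k<m. 0 \<le> v i k)"

definition bundles :: "nat \<Rightarrow> (nat \<Rightarrow> real) set" where
  "bundles m = {B. \<forall>k<m. 0 \<le> B k \<and> B k \<le> 1}"

definition utility :: "nat \<Rightarrow> (nat \<Rightarrow> nat \<Rightarrow> real) \<Rightarrow> nat \<Rightarrow> (nat \<Rightarrow> real) \<Rightarrow> real" where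
  "utility m v i B = (\<Sum>k<m. v i k * B k)"

definition allocations :: "nat \<Rightarrow> nat \<Rightarrow> (nat \<Rightarrow> nat \<Rightarrow> real) set" where
  "allocations n m =
     {A. (\<forall>i<n. A i \<in> bundles m) \<and> (\<forall>k<m. (\<Sum>i<n. A i k) \<le> 1)}"

definition efs_allocations ::
    "nat \<Rightarrow> nat \<Rightarrow> (nat \<Rightarrow> nat \<Rightarrow> real) \<Rightarrow> nat \<Rightarrow> (nat \<Rightarrow> nat \<Rightarrow> real) set" where
  "efs_allocations n m v i =
     {A \<in> allocations n m.
        \<forall>j \<in> {..<n} - {i}. utility m v j (A i) \<le> utility m v j (A j)}"

definition ccs_allocations ::
    "nat \<Rightarrow> nat \<Rightarrow> (nat \<Rightarrow> nat \<Rightarrow> real) \<Rightarrow> nat \<Rightarrow> (nat \<Rightarrow> nat \<Rightarrow> real) set" where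
  "ccs_allocations n m v i =
     {A \<in> allocations n m.
        \<forall>j \<in> {..<n} - {i}. \<forall>j' \<in> {..<n} - {i}. utility m v j (A i) \<le> utility m v j (A j')}"

text \<open>
  The suprema below are maxima, see \<open>efs_is_max\<close> and \<open>ccs_is_max\<close>.
\<close>

definition efs :: "nat \<Rightarrow> nat \<Rightarrow> (nat \<Rightarrow> nat \<Rightarrow> real) \<Rightarrow> nat \<Rightarrow> real" where
  "efs n m v i = (SUP A \<in> efs_allocations n m v i. utility m v i (A i))"

definition ccs :: "nat \<Rightarrow> nat \<Rightarrow> (nat \<Rightarrow> nat \<Rightarrow> real) \<Rightarrow> nat \<Rightarrow> real" where
  "ccs n m v i = (SUP A \<in> ccs_allocations n m v i. utility m v i (A i))"

text \<open>
  A notion of share is a function \<open>s\<close> with \<open>s n m v i\<close> the share of agent \<open>i\<close>.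
\<close>

definition approximable ::
    "(nat \<Rightarrow> nat \<Rightarrow> (nat \<Rightarrow> nat \<Rightarrow> real) \<Rightarrow> nat \<Rightarrow> real) \<Rightarrow> nat \<Rightarrow> nat \<Rightarrow> real \<Rightarrow> bool" where
  "approximable s n m a \<longleftrightarrow>
     (\<forall>v. fair_division_instance n m v \<longrightarrow>
        (\<exists>A \<in> allocations n m. \<forall>i<n. utility m v i (A i) \<ge> s n m v i / a))"

text \<open>
  Values in \<^typ>\<open>ereal\<close> make the infimum and supremum meaningful for every notion of share;
  for the two shares above the infimum is a minimum, see \<open>alpha_efs_is_min\<close> and
  \<open>alpha_ccs_is_min\<close>.
\<close>

definition alpha ::
    "(nat \<Rightarrow> nat \<Rightarrow> (nat \<Rightarrow> nat \<Rightarrow> real) \<Rightarrow> nat \<Rightarrow> real) \<Rightarrow> nat \<Rightarrow> nat \<Rightarrow> ereal" where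
  "alpha s n m = (INF a \<in> {a. 1 \<le> a \<and> approximable s n m a}. ereal a)"

definition alpha_sup ::
    "(nat \<Rightarrow> nat \<Rightarrow> (nat \<Rightarrow> nat \<Rightarrow> real) \<Rightarrow> nat \<Rightarrow> real) \<Rightarrow> nat \<Rightarrow> ereal" where
  "alpha_sup s n = (SUP m \<in> {1..}. alpha s n m)"

lemma compact_unit_functions:
  "compact {A :: nat \<Rightarrow> nat \<Rightarrow> real. \<forall>i k. 0 \<le> A i k \<and> A i k \<le> 1}"
proof -
  have 1: "compact {f :: nat \<Rightarrow> real. \<forall>k. f k \<in> {0..1}}"
  proof -
    have "compactin (product_topology (\<lambda>_::nat. euclidean :: real topology) UNIV)
            (PiE UNIV (\<lambda>_. {0..1}))"
      by (simp add: compactin_PiE)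
    then show ?thesis
      by (simp add: euclidean_product_topology PiE_UNIV_domain Pi_def)
  qed
  have "compactin (product_topology (\<lambda>_::nat. euclidean :: (nat \<Rightarrow> real) topology) UNIV)
          (PiE UNIV (\<lambda>_. {f. \<forall>k. f k \<in> {0..1}}))"
    using 1 by (simp add: compactin_PiE)
  then show ?thesis
    by (simp add: euclidean_product_topology PiE_UNIV_domain Pi_def)
qed

lemma continuous_entry: "continuous_on S (\<lambda>A :: nat \<Rightarrow> nat \<Rightarrow> real. A i k)"
  by (rule continuous_on_product_then_coordinatewise [OF
        continuous_on_product_then_coordinatewise [OF continuous_on_id]])

lemma continuous_utility: "continuous_on S (\<lambda>A :: nat \<Rightarrow> nat \<Rightarrow> real. utility m v j (A i))"
  unfolding utility_def by (intro continuous_intros continuous_entry)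

definition unit_functions :: "(nat \<Rightarrow> nat \<Rightarrow> real) set" where
  "unit_functions = {A. \<forall>i k. 0 \<le> A i k \<and> A i k \<le> 1}"

definition truncate :: "nat \<Rightarrow> nat \<Rightarrow> (nat \<Rightarrow> nat \<Rightarrow> real) \<Rightarrow> nat \<Rightarrow> nat \<Rightarrow> real" where
  "truncate n m A = (\<lambda>i k. if i < n \<and> k < m then A i k else 0)"

lemma utility_truncate [simp]: "i < n \<Longrightarrow> utility m v j (truncate n m A i) = utility m v j (A i)"
  by (simp add: utility_def truncate_def)

lemma truncate_mem:
  assumes "A \<in> allocations n m"
  shows "truncate n m A \<in> allocations n m" "truncate n m A \<in> unit_functions"
  using assms by (auto simp: allocations_def bundles_def truncate_def unit_functions_def)

lemma closed_allocations: "closed (allocations n m)"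
proof -
  have "allocations n m =
      (\<Inter>i\<in>{..<n}. \<Inter>k\<in>{..<m}. {A. 0 \<le> A i k} \<inter> {A. A i k \<le> 1}) \<inter>
      (\<Inter>k\<in>{..<m}. {A. (\<Sum>i<n. A i k) \<le> 1})"
    by (auto simp: allocations_def bundles_def)
  moreover have "closed \<dots>"
    by (intro closed_Int closed_INT ballI closed_Collect_le continuous_intros continuous_entry)
  ultimately show ?thesis by simp
qed

lemma closed_efs_allocations: "closed (efs_allocations n m v i)"
proof -
  have "efs_allocations n m v i = allocations n m \<inter>
      (\<Inter>j \<in> {..<n} - {i}. {A. utility m v j (A i) \<le> utility m v j (A j)})"
    by (auto simp: efs_allocations_def)
  moreover have "closed \<dots>"
    by (intro closed_Int closed_INT ballI closed_Collect_le continuous_utility closed_allocations)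
  ultimately show ?thesis by simp
qed

lemma closed_ccs_allocations: "closed (ccs_allocations n m v i)"
proof -
  have "ccs_allocations n m v i = allocations n m \<inter>
      (\<Inter>j \<in> {..<n} - {i}. \<Inter>j' \<in> {..<n} - {i}.
         {A. utility m v j (A i) \<le> utility m v j (A j')})"
    by (auto simp: ccs_allocations_def)
  moreover have "closed \<dots>"
    by (intro closed_Int closed_INT ballI closed_Collect_le continuous_utility closed_allocations)
  ultimately show ?thesis by simp
qed

lemma share_is_max:
  assumes S: "closed S" "S \<subseteq> allocations n m" "\<And>A. A \<in> S \<Longrightarrow> truncate n m A \<in> S"
    and "(\<lambda>_ _. 0) \<in> S" "i < n"
  shows "\<exists>A\<in>S. utility m v i (A i) = (SUP A\<in>S. utility m v i (A i)) \<and>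
           (\<forall>A'\<in>S. utility m v i (A' i) \<le> utility m v i (A i))"
proof -
  have "compact (S \<inter> unit_functions)"
    unfolding unit_functions_def by (rule closed_Int_compact [OF S(1) compact_unit_functions])
  moreover have "S \<inter> unit_functions \<noteq> {}"
    using assms(4) by (auto simp: unit_functions_def)
  ultimately obtain A where A: "A \<in> S \<inter> unit_functions"
    and *: "\<forall>A'\<in>S \<inter> unit_functions. utility m v i (A' i) \<le> utility m v i (A i)"
    using continuous_attains_sup [OF _ _ continuous_utility [of _ m v i i]] by metis
  have max: "utility m v i (A' i) \<le> utility m v i (A i)" if "A' \<in> S" for A'
  proof -
    have "truncate n m A' \<in> S \<inter> unit_functions"
      using that S truncate_mem by blast
    then have "utility m v i (truncate n m A' i) \<le> utility m v i (A i)"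
      using * by blast
    then show ?thesis using \<open>i < n\<close> by simp
  qed
  then have "(SUP A\<in>S. utility m v i (A i)) = utility m v i (A i)"
    using A by (intro cSup_eq_maximum) auto
  then show ?thesis using A max by auto
qed

lemma zero_allocation:
  "(\<lambda>_ _. 0) \<in> allocations n m" "(\<lambda>_ _. 0) \<in> efs_allocations n m v i"
  "(\<lambda>_ _. 0) \<in> ccs_allocations n m v i"
  by (auto simp: allocations_def efs_allocations_def ccs_allocations_def bundles_def)

lemma efs_is_max:
  assumes "i < n"
  shows "\<exists>A \<in> efs_allocations n m v i. utility m v i (A i) = efs n m v i \<and>
           (\<forall>A' \<in> efs_allocations n m v i. utility m v i (A' i) \<le> utility m v i (A i))"
  unfolding efs_def
proof (rule share_is_max [OF closed_efs_allocations _ _ _ assms])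
  fix A assume "A \<in> efs_allocations n m v i"
  then show "truncate n m A \<in> efs_allocations n m v i"
    using assms by (auto simp: efs_allocations_def truncate_mem)
qed (auto simp: efs_allocations_def zero_allocation)

lemma ccs_is_max:
  assumes "i < n"
  shows "\<exists>A \<in> ccs_allocations n m v i. utility m v i (A i) = ccs n m v i \<and>
           (\<forall>A' \<in> ccs_allocations n m v i. utility m v i (A' i) \<le> utility m v i (A i))"
  unfolding ccs_def
proof (rule share_is_max [OF closed_ccs_allocations _ _ _ assms])
  fix A assume "A \<in> ccs_allocations n m v i"
  then show "truncate n m A \<in> ccs_allocations n m v i"
    using assms by (auto simp: ccs_allocations_def truncate_mem)
qed (auto simp: ccs_allocations_def zero_allocation)

lemma utility_le_total:
  assumes "fair_division_instance n m v" "i < n" "A \<in> allocations n m"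
  shows "utility m v i (A i) \<le> (\<Sum>k<m. v i k)"
  unfolding utility_def
proof (rule sum_mono)
  fix k assume "k \<in> {..<m}"
  then have "0 \<le> v i k" "A i k \<le> 1"
    using assms by (auto simp: fair_division_instance_def allocations_def bundles_def)
  then show "v i k * A i k \<le> v i k"
    by (simp add: mult_left_le)
qed

lemma alpha_is_min:
  assumes n: "n \<ge> 1"
    and s: "\<And>v i. fair_division_instance n m v \<Longrightarrow> i < n \<Longrightarrow>
              0 \<le> s n m v i \<and> s n m v i \<le> (\<Sum>k<m. v i k)"
  shows "\<exists>a. alpha s n m = ereal a \<and> 1 \<le> a \<and> approximable s n m a \<and>
           (\<forall>b. 1 \<le> b \<and> approximable s n m b \<longrightarrow> a \<le> b)"
proof -
  define G where "G = {a. 1 \<le> a \<and> approximable s n m a}"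
  have "real n \<in> G"
  proof -
    have "\<exists>A \<in> allocations n m. \<forall>i<n. utility m v i (A i) \<ge> s n m v i / real n"
      if v: "fair_division_instance n m v" for v
    proof (intro bexI allI impI)
      show "(\<lambda>_ _. 1 / real n) \<in> allocations n m"
        using n by (auto simp: allocations_def bundles_def)
      fix i assume "i < n"
      then show "s n m v i / real n \<le> utility m v i (\<lambda>_. 1 / real n)"
        using s [OF v] n
        by (simp add: utility_def divide_right_mono flip: sum_divide_distrib)
    qed
    then show ?thesis using n by (simp add: G_def approximable_def)
  qed
  define a where "a = Inf G"
  have bdd: "bdd_below G" by (rule bdd_belowI [of _ 1]) (simp add: G_def)
  have le: "a \<le> b" if "b \<in> G" for b
    unfolding a_def by (rule cInf_lower [OF that bdd])
  have a1: "1 \<le> a"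
    unfolding a_def
  proof (rule cInf_greatest)
    show "G \<noteq> {}" using \<open>real n \<in> G\<close> by blast
  qed (simp add: G_def)
  have "approximable s n m a"
    unfolding approximable_def
  proof (intro allI impI)
    fix v assume v: "fair_division_instance n m v"
    define K where "K = allocations n m \<inter> unit_functions"
    define F where "F b = {A. \<forall>i<n. s n m v i / b \<le> utility m v i (A i)}" for b :: real
    have K: "compact K"
      unfolding K_def unit_functions_def
      by (rule closed_Int_compact [OF closed_allocations compact_unit_functions])
    have clF: "closed (F b)" for b
    proof -
      have "F b = (\<Inter>i\<in>{..<n}. {A. s n m v i / b \<le> utility m v i (A i)})"
        by (auto simp: F_def)
      then show ?thesis
        by (auto intro!: closed_INT closed_Collect_le continuous_utility continuous_intros)
    qed
    have mono: "F b \<subseteq> F c" if "b \<in> G" "b \<le> c" for b c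
    proof -
      have "s n m v i / c \<le> s n m v i / b" if "i < n" for i
        using s [OF v that] \<open>b \<in> G\<close> \<open>b \<le> c\<close> by (auto simp: G_def intro!: divide_left_mono)
      then show ?thesis unfolding F_def by (blast intro: order_trans)
    qed
    have ne: "K \<inter> F b \<noteq> {}" if "b \<in> G" for b
    proof -
      obtain A where A: "A \<in> allocations n m" "\<forall>i<n. utility m v i (A i) \<ge> s n m v i / b"
        using \<open>b \<in> G\<close> v by (auto simp: G_def approximable_def)
      then have "truncate n m A \<in> K \<inter> F b"
        by (auto simp: K_def F_def truncate_mem)
      then show ?thesis by blast
    qed
    have "K \<inter> (\<Inter>b\<in>G. F b) \<noteq> {}"
    proof (rule compact_imp_fip_image [OF K])
      fix I' assume I': "finite I'" "I' \<subseteq> G"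
      show "K \<inter> (\<Inter>b\<in>I'. F b) \<noteq> {}"
      proof (cases "I' = {}")
        case True
        then show ?thesis using ne [OF \<open>real n \<in> G\<close>] by auto
      next
        case False
        then have "Min I' \<in> G" using I' by (meson Min_in subsetD)
        moreover have "F (Min I') \<subseteq> (\<Inter>b\<in>I'. F b)"
          using mono [OF \<open>Min I' \<in> G\<close>] I' by (meson INT_greatest Min_le)
        ultimately show ?thesis using ne by blast
      qed
    qed (rule clF)
    then obtain A where A: "A \<in> K" "\<And>b. b \<in> G \<Longrightarrow> A \<in> F b" by blast
    have "s n m v i / a \<le> utility m v i (A i)" if "i < n" for i
    proof (cases "utility m v i (A i) > 0")
      case True
      have "s n m v i / utility m v i (A i) \<le> a"
        unfolding a_def
      proof (rule cInf_greatest)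
        fix b assume "b \<in> G"
        then have "s n m v i / b \<le> utility m v i (A i)" "b > 0"
          using A(2) that by (auto simp: F_def G_def)
        then show "s n m v i / utility m v i (A i) \<le> b"
          using True by (simp add: field_simps)
      qed (use \<open>real n \<in> G\<close> in blast)
      then show ?thesis using True a1 by (simp add: field_simps)
    next
      case False
      have "s n m v i / real n \<le> utility m v i (A i)"
        using A(2) [OF \<open>real n \<in> G\<close>] that by (simp add: F_def)
      moreover have "0 \<le> s n m v i / real n" using s [OF v that] n by simp
      ultimately have "s n m v i / real n = 0" "utility m v i (A i) = 0"
        using False by linarith+
      then show ?thesis using n by simp
    qed
    then show "\<exists>A\<in>allocations n m. \<forall>i<n. s n m v i / a \<le> utility m v i (A i)"
      using A(1) by (auto simp: K_def)
  qed
  then have aG: "a \<in> G" using a1 by (simp add: G_def)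
  have "alpha s n m = ereal a"
    unfolding alpha_def G_def [symmetric]
    using aG le by (intro antisym INF_lower INF_greatest) auto
  then show ?thesis using aG le by (auto simp: G_def)
qed

lemma alpha_efs_is_min:
  assumes "n \<ge> 1"
  shows "\<exists>a. alpha efs n m = ereal a \<and> 1 \<le> a \<and> approximable efs n m a \<and>
           (\<forall>b. 1 \<le> b \<and> approximable efs n m b \<longrightarrow> a \<le> b)"
proof (rule alpha_is_min [OF assms])
  fix v i assume v: "fair_division_instance n m v" and i: "i < n"
  obtain A where A: "A \<in> efs_allocations n m v i" "utility m v i (A i) = efs n m v i"
    and max: "\<And>A'. A' \<in> efs_allocations n m v i \<Longrightarrow> utility m v i (A' i) \<le> utility m v i (A i)"
    using efs_is_max [OF i] by metis
  have "0 \<le> efs n m v i"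
    using max [OF zero_allocation(2)] A(2) by (simp add: utility_def)
  moreover have "efs n m v i \<le> (\<Sum>k<m. v i k)"
    using utility_le_total [OF v i, of A] A by (simp add: efs_allocations_def)
  ultimately show "0 \<le> efs n m v i \<and> efs n m v i \<le> (\<Sum>k<m. v i k)" by blast
qed

lemma alpha_ccs_is_min:
  assumes "n \<ge> 1"
  shows "\<exists>a. alpha ccs n m = ereal a \<and> 1 \<le> a \<and> approximable ccs n m a \<and>
           (\<forall>b. 1 \<le> b \<and> approximable ccs n m b \<longrightarrow> a \<le> b)"
proof (rule alpha_is_min [OF assms])
  fix v i assume v: "fair_division_instance n m v" and i: "i < n"
  obtain A where A: "A \<in> ccs_allocations n m v i" "utility m v i (A i) = ccs n m v i"
    and max: "\<And>A'. A' \<in> ccs_allocations n m v i \<Longrightarrow> utility m v i (A' i) \<le> utility m v i (A i)"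
    using ccs_is_max [OF i] by metis
  have "0 \<le> ccs n m v i"
    using max [OF zero_allocation(3)] A(2) by (simp add: utility_def)
  moreover have "ccs n m v i \<le> (\<Sum>k<m. v i k)"
    using utility_le_total [OF v i, of A] A by (simp add: ccs_allocations_def)
  ultimately show "0 \<le> ccs n m v i \<and> ccs n m v i \<le> (\<Sum>k<m. v i k)" by blast
qed

end

theory Submission
  imports Defs "HOL-Algebra.Algebraic_Closure_Type" "HOL-Library.Z2"
begin

text \<open>
  For \<open>n \<ge> 2\<close>, agent \<open>i\<close> attains as cake-cutting share the value of any bundle that every other
  agent values at most at a fraction \<open>1 / n\<close> of everything, because the rest can then be split
  evenly. Let \<open>q\<close> be a power of two with \<open>q\<^sup>2 \<le> n < 4 q\<^sup>2\<close>. The items are the \<open>q\<^sup>2\<close> points of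
  an affine plane over a field with \<open>q\<close> elements, and one further item \<open>X\<close>. Each of \<open>q\<^sup>2\<close> agents
  has a line (non-vertical), values each of its \<open>q\<close> points at \<open>1\<close> and \<open>X\<close> at \<open>n - q\<close>; the remaining
  agents value only \<open>X\<close>, at \<open>n\<close>. Distinct lines meet in at most one point, so the line of an agent
  gives it a share of at least \<open>q\<close>. But the total welfare is at most \<open>q\<^sup>2 + n \<le> 2 n\<close>, while an
  \<open>a\<close>-approximation needs at least \<open>q\<^sup>2 \<cdot> q / a\<close>, so \<open>a \<ge> q\<^sup>3 / (2 n) \<ge> \<surd>n / 16\<close>.
\<close>

section \<open>Finite fields of characteristic two and their affine planes\<close>

text \<open>Over an algebraically closed field \<open>p\<close> splits into linear factors. Writing
  \<open>p = (X - x) * r\<close>, the derivative at \<open>x\<close> is \<open>r(x)\<close>, so a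
  nonzero derivative rules out a repeated root.\<close>

lemma card_simple_roots:
  fixes p :: "'a :: alg_closed_field poly"
  assumes "p \<noteq> 0" and simple: "\<And>x. poly p x = 0 \<Longrightarrow> poly (pderiv p) x \<noteq> 0"
  shows "card {x. poly p x = 0} = Polynomial.degree p"
proof -
  obtain A where A: "size A = Polynomial.degree p" "p = Polynomial.smult (Polynomial.lead_coeff p) (\<Prod>x\<in>#A. [:-x, 1:])"
    using alg_closed_imp_factorization [OF \<open>p \<noteq> 0\<close>] by blast
  have roots: "poly p x = 0 \<longleftrightarrow> x \<in># A" for x
    by (subst A(2)) (use \<open>p \<noteq> 0\<close> in \<open>auto simp: poly_prod_mset prod_mset_zero_iff\<close>)
  have "count A x = 1" if "x \<in># A" for x
  proof -
    obtain B where B: "A = add_mset x B"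
      using \<open>x \<in># A\<close> by (metis mset_add)
    define r where "r = Polynomial.smult (Polynomial.lead_coeff p) (\<Prod>y\<in>#B. [:-y, 1:])"
    have p: "p = [:-x, 1:] * r"
      by (subst A(2)) (simp add: B r_def)
    have "poly (pderiv p) x = poly r x"
      unfolding p pderiv_mult by (simp add: pderiv_pCons)
    then have "poly r x \<noteq> 0"
      using simple [of x] roots [of x] that by simp
    then have "x \<notin># B"
      by (auto simp: r_def poly_prod_mset prod_mset_zero_iff)
    then show ?thesis
      by (simp add: B not_in_iff)
  qed
  then have "size A = card (set_mset A)"
    by (simp add: size_multiset_overloaded_eq)
  moreover have "{x. poly p x = 0} = set_mset A"
    using roots by auto
  ultimately show ?thesis
    using A(1) by simp
qed

lemma CHAR_bit [simp]: "CHAR(bit) = 2"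
proof (rule CHAR_eq_posI)
  show "of_nat x \<noteq> (0 :: bit)" if "0 < x" "x < 2" for x
  proof -
    have "x = 1" using that by linarith
    then show ?thesis by simp
  qed
qed auto

text \<open>For \<open>k > 0\<close>, \<open>F\<close> is the field with \<open>q = 2 ^ k\<close>
  elements inside the algebraic closure of \<open>bit\<close>: the roots of \<open>X^q - X\<close>,
  that is, the fixed points of an iterate of the Frobenius map.\<close>

lemma finite_subring_char_2:
  "\<exists>F :: bit alg_closure set. finite F \<and> card F = 2 ^ k \<and>
     (\<forall>x\<in>F. \<forall>y\<in>F. x + y \<in> F \<and> x * y \<in> F)"
proof (cases "k = 0")
  case True
  \<comment> \<open>For \<open>q = 1\<close> the polynomial \<open>X^q - X\<close> vanishes, so a
    singleton closed under both operations is given directly.\<close>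
  then show ?thesis by (intro exI [of _ "{0}"]) auto
next
  case False
  define q :: nat where "q = 2 ^ k"
  have q: "q > 1" using False by (simp add: q_def one_less_power del: One_nat_def)
  define p :: "bit alg_closure poly" where "p = Polynomial.monom 1 q - Polynomial.monom 1 1"
  define F :: "bit alg_closure set" where "F = {x. poly p x = 0}"
  have F: "x \<in> F \<longleftrightarrow> x ^ q = x" for x
    by (simp add: F_def p_def poly_monom)
  have "Polynomial.degree p = q"
    unfolding p_def using q by (subst diff_conv_add_uminus, subst degree_add_eq_left)
      (auto simp: degree_monom_eq simp flip: minus_monom)
  then have "p \<noteq> 0" using q by auto
  \<comment> \<open>The derivative \<open>q X^(q-1) - 1\<close> is the constant \<open>-1\<close>
    because \<open>q\<close> is even, so every root is simple.\<close>
  have "of_nat q = (0 :: bit alg_closure)"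
    unfolding of_nat_eq_0_iff_char_dvd using False by (simp add: q_def)
  then have "poly (pderiv p) x = -1" for x
    by (simp add: p_def pderiv_diff pderiv_monom poly_monom)
  then have "card F = 2 ^ k"
    unfolding F_def using card_simple_roots [OF \<open>p \<noteq> 0\<close>] \<open>Polynomial.degree p = q\<close> by (simp add: q_def)
  moreover have "finite F"
    unfolding F_def by (rule poly_roots_finite [OF \<open>p \<noteq> 0\<close>])
  moreover have "x + y \<in> F" "x * y \<in> F" if "x \<in> F" "y \<in> F" for x y
    \<comment> \<open>In characteristic 2 raising to the power \<open>2 ^ k\<close> is additive as
      well as multiplicative.\<close>
    using that freshmans_dream' [of q k x y]
    by (auto simp: F q_def power_mult_distrib)
  ultimately show ?thesis by blast
qed

lemma affine_plane_exists:
  fixes k :: nat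
  defines "q \<equiv> 2 ^ k"
  obtains S :: "nat \<Rightarrow> nat set"
  where "\<And>i. i < q\<^sup>2 \<Longrightarrow> S i \<subseteq> {..<q\<^sup>2}" "\<And>i. i < q\<^sup>2 \<Longrightarrow> card (S i) = q"
    "\<And>i j. i < q\<^sup>2 \<Longrightarrow> j < q\<^sup>2 \<Longrightarrow> i \<noteq> j \<Longrightarrow> card (S i \<inter> S j) \<le> 1"
proof -
  obtain F :: "bit alg_closure set" where "finite F" and cardF: "card F = q"
    and closed: "\<And>x y. x \<in> F \<Longrightarrow> y \<in> F \<Longrightarrow> x + y \<in> F \<and> x * y \<in> F"
    using finite_subring_char_2 [of k] unfolding q_def by blast
  define line where "line = (\<lambda>(a, b). (\<lambda>x. (x, a * x + b)) ` F)"
  have line_sub: "line l \<subseteq> F \<times> F" if "l \<in> F \<times> F" for l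
    using that closed by (auto simp: line_def)
  have line_card: "card (line l) = q" for l
    by (cases l) (simp add: line_def card_image inj_on_def cardF)
  have meet: "P = Q" if ne: "l \<noteq> l'" and PQ: "P \<in> line l \<inter> line l'" "Q \<in> line l \<inter> line l'" for l l' P Q
  proof -
    obtain a b c d where l: "l = (a, b)" "l' = (c, d)" by (metis surj_pair)
    obtain x y where P: "P = (x, a * x + b)" "Q = (y, a * y + b)"
      and eq: "a * x + b = c * x + d" "a * y + b = c * y + d"
    proof -
      from PQ(1) obtain x where "P = (x, a * x + b)" "P = (x, c * x + d)"
        by (auto simp: line_def l)
      moreover from PQ(2) obtain y where "Q = (y, a * y + b)" "Q = (y, c * y + d)"
        by (auto simp: line_def l)
      ultimately show thesis using that by simp
    qed
    \<comment> \<open>Subtracting the equations at two common points shows that either the slopes or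
      the abscissae agree. Equal slopes would force equal intercepts, hence equal lines.\<close>
    have "(a - c) * (x - y) = (a * x + b) - (c * x + d) - ((a * y + b) - (c * y + d))"
      by (simp add: algebra_simps)
    also have "\<dots> = 0" by (simp only: eq diff_self)
    finally have "a = c \<or> x = y" by simp
    moreover have "a \<noteq> c" using eq ne l by auto
    ultimately show ?thesis by (simp add: P)
  qed
  have "card (F \<times> F) = q\<^sup>2"
    by (simp add: card_cartesian_product cardF power2_eq_square)
  then obtain e where e: "bij_betw e {..<q\<^sup>2} (F \<times> F)"
    using ex_bij_betw_nat_finite [of "F \<times> F"] \<open>finite F\<close> by (auto simp: atLeast0LessThan)
  \<comment> \<open>The numbering \<open>e\<close> serves twice: \<open>e j\<close> is a point,
    while \<open>e i\<close> is the slope and intercept of a line.\<close>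
  define S where "S i = {j \<in> {..<q\<^sup>2}. e j \<in> line (e i)}" for i
  have e_inj: "e i = e j \<Longrightarrow> i = j" if "i < q\<^sup>2" "j < q\<^sup>2" for i j
    using e that by (auto simp: bij_betw_def inj_on_def)
  show thesis
  proof
    fix i assume i: "i < q\<^sup>2"
    show "S i \<subseteq> {..<q\<^sup>2}" by (auto simp: S_def)
    have "e i \<in> F \<times> F" using e i by (auto simp: bij_betw_def)
    then have "line (e i) \<subseteq> e ` {..<q\<^sup>2}"
      using line_sub e by (simp add: bij_betw_def)
    then have "e ` S i = line (e i)"
      unfolding S_def by blast
    then have "card (line (e i)) = card (S i)"
      using card_image [of e "S i"] e_inj by (simp add: inj_on_def S_def)
    then show "card (S i) = q" by (simp add: line_card)
    fix j assume j: "j < q\<^sup>2" "i \<noteq> j"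
    have "e i \<noteq> e j" using e_inj i j by blast
    then have "x = y" if "x \<in> S i \<inter> S j" "y \<in> S i \<inter> S j" for x y
      using meet [of "e i" "e j" "e x" "e y"] that e_inj [of x y] by (auto simp: S_def)
    then show "card (S i \<inter> S j) \<le> 1"
      by (simp add: S_def card_le_Suc0_iff_eq)
  qed
qed

section \<open>Shares and welfare\<close>

text \<open>Taking \<open>j' = j\<close> in the cake-cutting constraints yields the envy-free ones,
  so the envy-free maximum ranges over a larger set.\<close>

lemma ccs_le_efs:
  assumes "i < n"
  shows "ccs n m v i \<le> efs n m v i"
proof -
  obtain A where "A \<in> ccs_allocations n m v i" "utility m v i (A i) = ccs n m v i"
    using ccs_is_max [OF assms] by blast
  moreover from this have "A \<in> efs_allocations n m v i"
    by (auto simp: ccs_allocations_def efs_allocations_def)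
  ultimately show ?thesis
    using efs_is_max [OF assms, of m v] by metis
qed

lemma alpha_mono:
  assumes "\<And>v i. i < n \<Longrightarrow> s n m v i \<le> t n m v i"
  shows "alpha s n m \<le> alpha t n m"
  unfolding alpha_def
proof (rule INF_superset_mono)
  show "{a. 1 \<le> a \<and> approximable t n m a} \<subseteq> {a. 1 \<le> a \<and> approximable s n m a}"
  proof clarify
    fix a :: real assume a: "1 \<le> a" "approximable t n m a"
    then have "s n m v i / a \<le> t n m v i / a" if "i < n" for v i
      using assms that by (simp add: divide_right_mono)
    then show "approximable s n m a"
      using a(2) unfolding approximable_def by (meson order_trans)
  qed
qed simp

lemma alpha_sup_mono:
  assumes "\<And>m v i. i < n \<Longrightarrow> s n m v i \<le> t n m v i"
  shows "alpha_sup s n \<le> alpha_sup t n"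
  unfolding alpha_sup_def by (intro SUP_mono' alpha_mono assms)

lemma utility_le_ccs:
  assumes B: "B \<in> bundles m" and i: "i < n"
    and small: "\<And>j. j < n \<Longrightarrow> j \<noteq> i \<Longrightarrow> real n * utility m v j B \<le> (\<Sum>k<m. v j k)"
  shows "utility m v i B \<le> ccs n m v i"
proof -
  define R where "R k = (1 - B k) / (real n - 1)" for k
  define A where "A j = (if j = i then B else R)" for j
  have R: "R \<in> bundles m" if "n > 1"
    unfolding bundles_def R_def
  proof (clarify, intro conjI)
    fix k assume "k < m"
    then have "0 \<le> B k" "B k \<le> 1" using B by (auto simp: bundles_def)
    moreover have "real n - 1 \<ge> 1" using that by simp
    ultimately show "0 \<le> (1 - B k) / (real n - 1)" "(1 - B k) / (real n - 1) \<le> 1"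
      by (simp_all add: divide_le_eq)
  qed
  have "(\<Sum>j<n. A j k) \<le> 1" if "k < m" for k
  proof -
    have "(\<Sum>j<n. A j k) = A i k + (\<Sum>j\<in>{..<n} - {i}. A j k)"
      using i by (simp add: sum.remove)
    also have "(\<Sum>j\<in>{..<n} - {i}. A j k) = (\<Sum>j\<in>{..<n} - {i}. R k)"
      by (rule sum.cong) (auto simp: A_def)
    also have "\<dots> = (real n - 1) * R k"
      using i by (simp add: of_nat_diff)
    \<comment> \<open>This is an equality for \<open>n > 1\<close>; for \<open>n = 1\<close>
      division by zero makes the left side 0.\<close>
    also have "\<dots> \<le> 1 - B k"
      using B that by (simp add: R_def bundles_def)
    finally show ?thesis by (simp add: A_def)
  qed
  moreover have "A j \<in> bundles m" if "j < n" for j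
    using B R i that by (cases "j = i") (auto simp: A_def)
  ultimately have "A \<in> allocations n m"
    by (simp add: allocations_def)
  moreover have "utility m v j B \<le> utility m v j R" if j: "j < n" "j \<noteq> i" for j
  proof -
    have "utility m v j R = ((\<Sum>k<m. v j k) - utility m v j B) / (real n - 1)"
      by (simp add: utility_def R_def right_diff_distrib sum_subtractf flip: sum_divide_distrib)
    moreover have "real n - 1 > 0" using i j by auto
    \<comment> \<open>With \<open>u\<close> the value of \<open>B\<close> and \<open>T\<close> the
      total, \<open>n * u \<le> T\<close> rearranges to
      \<open>u \<le> (T - u) / (n - 1)\<close>.\<close>
    ultimately show ?thesis
      using small [OF j] by (simp add: pos_le_divide_eq algebra_simps)
  qed
  ultimately have "A \<in> ccs_allocations n m v i"
    by (auto simp: ccs_allocations_def A_def)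
  then have "utility m v i (A i) \<le> ccs n m v i"
    using ccs_is_max [OF i, of m v] by metis
  then show ?thesis by (simp add: A_def)
qed

text \<open>Weak linear programming duality, with \<open>p k\<close> as the price of item \<open>k\<close>.\<close>

lemma welfare_le:
  assumes A: "A \<in> allocations n m" and "N \<le> n"
    and p: "\<And>i k. i < N \<Longrightarrow> k < m \<Longrightarrow> v i k \<le> p k" "\<And>k. k < m \<Longrightarrow> 0 \<le> p k"
  shows "(\<Sum>i<N. utility m v i (A i)) \<le> (\<Sum>k<m. p k)"
proof -
  have A0: "0 \<le> A i k" if "i < n" "k < m" for i k
    using A that by (simp add: allocations_def bundles_def)
  have "(\<Sum>i<N. utility m v i (A i)) = (\<Sum>k<m. \<Sum>i<N. v i k * A i k)"
    unfolding utility_def by (rule sum.swap)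
  also have "\<dots> \<le> (\<Sum>k<m. p k)"
  proof (rule sum_mono)
    fix k assume "k \<in> {..<m}"
    then have k: "k < m" by simp
    have "(\<Sum>i<N. v i k * A i k) \<le> (\<Sum>i<N. p k * A i k)"
      using A0 k \<open>N \<le> n\<close> p by (intro sum_mono mult_right_mono) auto
    also have "\<dots> = p k * (\<Sum>i<N. A i k)"
      by (simp add: sum_distrib_left)
    also have "(\<Sum>i<N. A i k) \<le> (\<Sum>i<n. A i k)"
      using A0 k \<open>N \<le> n\<close> by (intro sum_mono2) auto
    then have "p k * (\<Sum>i<N. A i k) \<le> p k * (\<Sum>i<n. A i k)"
      using p(2) [OF k] by (rule mult_left_mono)
    also have "\<dots> \<le> p k"
      using A k p(2) [OF k] by (simp add: allocations_def mult_left_le)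
    finally show "(\<Sum>i<N. v i k * A i k) \<le> p k" .
  qed
  finally show ?thesis .
qed

section \<open>The lower bound\<close>

lemma approximable_ccs_ge:
  fixes k :: nat
  defines "q \<equiv> 2 ^ k"
  assumes qn: "q\<^sup>2 \<le> n" and a: "1 \<le> a" "approximable ccs n (Suc (q\<^sup>2)) a"
  shows "real q ^ 3 \<le> 2 * real n * a"
proof -
  obtain S :: "nat \<Rightarrow> nat set" where S: "\<And>i. i < q\<^sup>2 \<Longrightarrow> S i \<subseteq> {..<q\<^sup>2}"
    "\<And>i. i < q\<^sup>2 \<Longrightarrow> card (S i) = q"
    "\<And>i j. i < q\<^sup>2 \<Longrightarrow> j < q\<^sup>2 \<Longrightarrow> i \<noteq> j \<Longrightarrow> card (S i \<inter> S j) \<le> 1"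
    using affine_plane_exists [of k] unfolding q_def by blast
  define m where "m = Suc (q\<^sup>2)"
  have "q \<le> q\<^sup>2" by (simp add: q_def power2_eq_square)
  then have "q \<le> n" using qn by linarith
  \<comment> \<open>Index \<open>q\<^sup>2\<close> is the item \<open>X\<close>. Its value tops up
    every agent's total to \<open>n\<close>, so the threshold of a fraction \<open>1 / n\<close> is
    exactly 1, the most that two distinct lines can share.\<close>
  define v :: "nat \<Rightarrow> nat \<Rightarrow> real" where
    "v i k = (if k < q\<^sup>2 then of_bool (i < q\<^sup>2 \<and> k \<in> S i) else if i < q\<^sup>2 then real n - real q else real n)"
    for i k
  have v: "fair_division_instance n m v"
    using \<open>q \<le> n\<close> by (simp add: fair_division_instance_def v_def)
  have on_points: "(\<Sum>k<q\<^sup>2. v i k * of_bool (k \<in> T)) = real (card (S i \<inter> T))" if "i < q\<^sup>2" for i T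
  proof -
    have "(\<Sum>k<q\<^sup>2. v i k * of_bool (k \<in> T)) = (\<Sum>k<q\<^sup>2. of_bool (k \<in> S i \<inter> T))"
      using that by (intro sum.cong) (auto simp: v_def)
    also have "\<dots> = real (card ({..<q\<^sup>2} \<inter> (S i \<inter> T)))"
      by (simp add: Int_def)
    also have "{..<q\<^sup>2} \<inter> (S i \<inter> T) = S i \<inter> T"
      using S(1) [OF that] by blast
    finally show ?thesis .
  qed
  have total: "(\<Sum>k<m. v i k) = real n" for i
  proof (cases "i < q\<^sup>2")
    case True
    then show ?thesis
      using on_points [of i UNIV] S(2) by (simp add: m_def) (simp add: v_def)
  qed (simp add: m_def v_def)
  have on_line: "utility m v j (\<lambda>k. of_bool (k \<in> S i)) =
      (if j < q\<^sup>2 then real (card (S j \<inter> S i)) else 0)" if "i < q\<^sup>2" for i j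
  proof -
    have "q\<^sup>2 \<notin> S i" using S(1) [OF that] by auto
    then show ?thesis
      using on_points [of j "S i"] by (simp add: utility_def m_def) (simp add: v_def)
  qed
  have share: "real q \<le> ccs n m v i" if i: "i < q\<^sup>2" for i
  proof -
    have "utility m v j (\<lambda>k. of_bool (k \<in> S i)) \<le> 1" if "j \<noteq> i" for j
      using S(3) [of j i] i that by (simp add: on_line [OF i])
    then have "utility m v i (\<lambda>k. of_bool (k \<in> S i)) \<le> ccs n m v i"
      using i qn by (intro utility_le_ccs) (auto simp: bundles_def total mult_left_le)
    then show ?thesis using i S(2) by (simp add: on_line)
  qed
  obtain A where A: "A \<in> allocations n m" "\<And>i. i < n \<Longrightarrow> ccs n m v i / a \<le> utility m v i (A i)"
    using a(2) v unfolding approximable_def m_def by blast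
  have "real (q\<^sup>2) * (real q / a) = (\<Sum>i<q\<^sup>2. real q / a)" by simp
  also have "\<dots> \<le> (\<Sum>i<q\<^sup>2. utility m v i (A i))"
  proof (rule sum_mono)
    fix i assume "i \<in> {..<q\<^sup>2}"
    then have i: "i < q\<^sup>2" by simp
    have "real q / a \<le> ccs n m v i / a" using share [OF i] a(1) by (simp add: divide_right_mono)
    also have "\<dots> \<le> utility m v i (A i)" using A(2) i qn by simp
    finally show "real q / a \<le> utility m v i (A i)" .
  qed
  \<comment> \<open>Prices: 1 for each point and \<open>n\<close> for \<open>X\<close>, which
    dominate all valuations.\<close>
  also have "\<dots> \<le> (\<Sum>k<m. if k < q\<^sup>2 then 1 else real n)"
    by (rule welfare_le [OF A(1) qn]) (auto simp: v_def)
  also have "\<dots> = real (q\<^sup>2) + real n" by (simp add: m_def)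
  also have "\<dots> \<le> 2 * real n" using qn by (simp del: of_nat_power)
  finally show ?thesis
    using a(1) by (simp add: pos_divide_le_eq power3_eq_cube power2_eq_square)
qed

lemma alpha_sup_ccs_ge:
  assumes "n \<ge> 1"
  shows "ereal (1 / 16 * sqrt (real n)) \<le> alpha_sup ccs n"
proof -
  obtain k where k: "4 ^ k \<le> n" "n < 4 ^ (k + 1)"
    using ex_power_ivl1 [of 4 n] assms by auto
  define q :: nat where "q = 2 ^ k"
  have q2: "q\<^sup>2 = 4 ^ k" by (simp add: q_def power2_eq_square flip: power_mult_distrib)
  have sq: "sqrt (real n) \<le> 2 * real q"
  proof (rule real_le_lsqrt)
    have "real n \<le> real (4 * q\<^sup>2)" using k(2) unfolding q2 of_nat_le_iff by simp
    then show "real n \<le> (2 * real q)\<^sup>2" by (simp add: power_mult_distrib)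
  qed simp
  have "ereal (1 / 16 * sqrt (real n)) \<le> alpha ccs n (Suc (q\<^sup>2))"
    unfolding alpha_def
  proof (rule INF_greatest)
    fix a assume "a \<in> {a. 1 \<le> a \<and> approximable ccs n (Suc (q\<^sup>2)) a}"
    then have "real q ^ 3 \<le> 2 * real n * a"
      using approximable_ccs_ge [of k n a] k(1) by (simp add: q2 flip: q_def)
    moreover have "(sqrt (real n)) ^ 3 \<le> (2 * real q) ^ 3"
      using sq by (intro power_mono) simp_all
    moreover have "(sqrt (real n)) ^ 3 = real n * sqrt (real n)"
      by (simp add: power3_eq_cube)
    \<comment> \<open>The constant 16 arises as
      \<open>n * sqrt n \<le> 8 * q^3 \<le> 8 * (2 * n * a)\<close>.\<close>
    ultimately have "real n * sqrt (real n) \<le> real n * (16 * a)"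
      by (simp add: power_mult_distrib)
    then show "ereal (1 / 16 * sqrt (real n)) \<le> ereal a"
      using assms by simp
  qed
  also have "\<dots> \<le> alpha_sup ccs n"
    unfolding alpha_sup_def by (rule SUP_upper) simp
  finally show ?thesis .
qed

theorem theorem2:
  shows "\<exists>c::real. c > 0 \<and>
           (\<forall>n::nat. n \<ge> 1 \<longrightarrow>
              ereal (c * sqrt (real n)) \<le> alpha_sup ccs n \<and>
              ereal (c * sqrt (real n)) \<le> alpha_sup efs n)"
proof (intro exI [of _ "1 / 16"] conjI allI impI)
  fix n :: nat assume "n \<ge> 1"
  then show "ereal (1 / 16 * sqrt (real n)) \<le> alpha_sup ccs n"
    by (rule alpha_sup_ccs_ge)
  also have "\<dots> \<le> alpha_sup efs n"
    by (intro alpha_sup_mono ccs_le_efs)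
  finally show "ereal (1 / 16 * sqrt (real n)) \<le> alpha_sup efs n" .
qed simp

end
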